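(* Let $n\geq 1$ and let $k$ be a domain. For any $\mathbf{w}=(w_1,\ldots,w_n)\in(\Gamma_{\geq 0})^n$, let $\mathrm{C}(\mathbf{w},k)$ be the set of the $\mathbf{w}$-degrees $\deg_{\mathbf{w}}f$ of all stable coordinates $f$ of $k[x_1,\ldots,x_n]$ over $k$, and let $\mathrm{C}(\mathbf{w})$ be the set of $d\in\Gamma$ for which there exists $1\leq i\leq n$ such that $d\geq w_i$ and $d=\sum_{j\neq i}a_jw_j$ for some $a_j\in\mathbb{Z}_{\geq 0}$ ($j\neq i$). Then $$\mathrm{C}(\mathbf{w},k)=\mathrm{C}(\mathbf{w})\cup\{w_1,\ldots,w_n\}.$$
   Context: An element $f\in k[x_1,\ldots,x_n]$ is a coordinate of $k[x_1,\ldots,x_n]$ over $k$ if $f=F(x_i)$ for some $k$-algebra automorphism $F$ of $k[x_1,\ldots,x_n]$ and some $1\leq i\leq n$. It is a stable coordinate of $k[x_1,\ldots,x_n]$ over $k$ if it is a coordinate of $k[x_1,\ldots,x_m]$ over $k$ for some $m\geq n$. $\Gamma$ is a totally ordered additive group, i.e. an additive (abelian) group with a total ordering such that $\alpha\leq\beta$ implies $\alpha+\gamma\leq\beta+\gamma$; $\Gamma_{\geq 0}=\{\gamma\in\Gamma\mid\gamma\geq 0\}$. For nonzero $f$, $\deg_{\mathbf{w}}f$ is the maximum of $\sum_i a_iw_i$ over the monomials $x_1^{a_1}\cdots x_n^{a_n}$ appearing in $f$ with nonzero coefficient. An empty sum (occurring when $n=1$) is $0$. *)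

theory Defs
  imports "HOL-Library.Poly_Mapping"
begin

text \<open>Polynomials over \<open>'k\<close> in countably many variables, indexed by \<^typ>\<open>nat\<close>: finitely
  supported maps from exponent vectors to coefficients, with the convolution product.\<close>

type_synonym 'k mpoly = "(nat \<Rightarrow>\<^sub>0 nat) \<Rightarrow>\<^sub>0 'k"

definition Var :: "nat \<Rightarrow> 'k::comm_ring_1 mpoly" where
  "Var i = Poly_Mapping.single (Poly_Mapping.single i 1) 1"

definition Const :: "'k::comm_ring_1 \<Rightarrow> 'k mpoly" where
  "Const c = Poly_Mapping.single 0 c"

text \<open>The ring $k[x_1,\dots,x_n]$. Keeping $n$ out of the type makes
  $k[x_1,\dots,x_n] \subseteq k[x_1,\dots,x_m]$ for $n \le m$ a literal inclusion.\<close>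

definition polys :: "nat \<Rightarrow> 'k::comm_ring_1 mpoly set" where
  "polys n = {f. \<forall>a \<in> Poly_Mapping.keys f. Poly_Mapping.keys a \<subseteq> {1..n}}"

text \<open>Only the restriction of \<open>F\<close> to \<^term>\<open>polys n\<close> is relevant.\<close>

definition algebra_automorphism ::
    "nat \<Rightarrow> ('k::comm_ring_1 mpoly \<Rightarrow> 'k mpoly) \<Rightarrow> bool" where
  "algebra_automorphism n F \<longleftrightarrow>
     bij_betw F (polys n) (polys n) \<and>
     (\<forall>f \<in> polys n. \<forall>g \<in> polys n. F (f + g) = F f + F g) \<and>
     (\<forall>f \<in> polys n. \<forall>g \<in> polys n. F (f * g) = F f * F g) \<and>
     (\<forall>c. F (Const c) = Const c)"

definition coordinate :: "nat \<Rightarrow> 'k::comm_ring_1 mpoly \<Rightarrow> bool" where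
  "coordinate n f \<longleftrightarrow> (\<exists>F. algebra_automorphism n F \<and> (\<exists>i \<in> {1..n}. f = F (Var i)))"

definition stable_coordinate :: "nat \<Rightarrow> 'k::comm_ring_1 mpoly \<Rightarrow> bool" where
  "stable_coordinate n f \<longleftrightarrow> f \<in> polys n \<and> (\<exists>m \<ge> n. coordinate m f)"

text \<open>The multiple $a \cdot g$ of an element of an additive group by a natural number.\<close>

definition nat_times :: "nat \<Rightarrow> 'g::comm_monoid_add \<Rightarrow> 'g" (infixr "\<cdot>" 75) where
  "a \<cdot> g = (\<Sum>_ \<in> {..<a}. g)"

text \<open>Meaningful for nonzero \<open>f\<close> in \<^term>\<open>polys n\<close>; only the weights
  $w_1,\dots,w_n$ are used.\<close>

definition wdeg ::
    "nat \<Rightarrow> (nat \<Rightarrow> 'g::linordered_ab_group_add) \<Rightarrow> 'k::comm_ring_1 mpoly \<Rightarrow> 'g" where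
  "wdeg n w f =
     Max ((\<lambda>a. \<Sum>i = 1..n. Poly_Mapping.lookup a i \<cdot> w i) ` Poly_Mapping.keys f)"

text \<open>The sets $\mathrm{C}(\mathbf{w},k)$ and $\mathrm{C}(\mathbf{w})$. The coefficient ring is a
  type, passed as \<open>TYPE('k)\<close>.\<close>

definition C_over ::
    "nat \<Rightarrow> (nat \<Rightarrow> 'g::linordered_ab_group_add) \<Rightarrow> 'k::comm_ring_1 itself \<Rightarrow> 'g set" where
  "C_over n w k = {wdeg n w f | f :: 'k mpoly. stable_coordinate n f}"

definition C_set :: "nat \<Rightarrow> (nat \<Rightarrow> 'g::linordered_ab_group_add) \<Rightarrow> 'g set" where
  "C_set n w =
     {d. \<exists>i \<in> {1..n}. d \<ge> w i \<and> (\<exists>a. d = (\<Sum>j \<in> {1..n} - {i}. a j \<cdot> w j))}"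

end

theory Submission
  imports Defs
begin

text \<open>
  The inclusion from right to left is witnessed by elementary automorphisms: if
  \<open>d = \<Sum>\<^sub>j\<^sub>\<noteq>\<^sub>i c\<^sub>j w\<^sub>j \<ge> w\<^sub>i\<close>, then adding to \<open>x\<^sub>i\<close> the monomial with exponents \<open>c\<^sub>j\<close>
  gives a coordinate of degree \<open>d\<close>.

  For the other inclusion let \<open>f = F(x\<^sub>j)\<close> be a stable coordinate of degree \<open>d\<close>, where \<open>F\<close> is an
  automorphism of the polynomial ring in \<open>m \<ge> n\<close> variables, and let \<open>I\<close> be the set of those
  \<open>i \<le> n\<close> with \<open>w\<^sub>i \<le> d\<close>. As the weights are nonnegative, only variables with index in \<open>I\<close> occur
  in \<open>f\<close>. If a monomial of degree \<open>d\<close> in \<open>f\<close> omits some \<open>x\<^sub>i\<close> with \<open>i \<in> I\<close>, then its exponents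
  show that \<open>d\<close> lies in \<open>C(w)\<close>. It remains to treat an \<open>f\<close> whose leading form is divisible by all
  \<open>x\<^sub>i\<close>, \<open>i \<in> I\<close>.

  Conjugating by \<open>F\<close> the map that fixes \<open>x\<^sub>j\<close> and scales every other variable by \<open>1 + t\<close> gives a
  ring homomorphism \<open>\<psi>\<close> into polynomials with one more variable \<open>t\<close>, which fixes \<open>f\<close> and is the
  identity at \<open>t = 0\<close>. In a domain, \<open>t\<close>-degrees add up under multiplication, so a homomorphism
  fixing a product fixes its factors; passing to leading terms for a suitable weight of \<open>t\<close>, the
  same holds for the factors of the leading form of \<open>f\<close>
  (\<open>subst_fixing_fixes_leading_factors\<close>). Hence \<open>\<psi>\<close> fixes \<open>x\<^sub>i\<close> for \<open>i \<in> I\<close>. But at \<open>t = -1\<close> the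
  image of \<open>\<psi>\<close> collapses to polynomials in \<open>f\<close> alone, so \<open>x\<^sub>i\<close> is a constant plus a multiple of
  \<open>f\<close>. Then the leading monomial of \<open>f\<close> divides \<open>x\<^sub>i\<close> and involves \<open>x\<^sub>i\<close>, hence is \<open>x\<^sub>i\<close>, and
  \<open>d = w\<^sub>i\<close> (\<open>coordinate_leading_monomials\<close>).
\<close>

section \<open>Substitution of polynomials for variables\<close>

definition polys_in :: "nat set \<Rightarrow> 'k::comm_ring_1 mpoly set" where
  "polys_in X = {f. \<forall>a \<in> Poly_Mapping.keys f. Poly_Mapping.keys a \<subseteq> X}"

lemma polys_eq_polys_in: "polys n = polys_in {1..n}"
  by (simp add: polys_def polys_in_def)

definition eval_monomial :: "(nat \<Rightarrow> 'a::comm_monoid_mult) \<Rightarrow> (nat \<Rightarrow>\<^sub>0 nat) \<Rightarrow> 'a" where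
  "eval_monomial s a = (\<Prod>i \<in> Poly_Mapping.keys a. s i ^ Poly_Mapping.lookup a i)"

definition subst :: "(nat \<Rightarrow> 'k mpoly) \<Rightarrow> 'k mpoly \<Rightarrow> 'k::comm_ring_1 mpoly" where
  "subst s p = (\<Sum>a \<in> Poly_Mapping.keys p. Const (Poly_Mapping.lookup p a) * eval_monomial s a)"

lemma eval_monomial_superset:
  assumes "finite X" "Poly_Mapping.keys a \<subseteq> X"
  shows "eval_monomial s a = (\<Prod>i \<in> X. s i ^ Poly_Mapping.lookup a i)"
  unfolding eval_monomial_def
  by (rule prod.mono_neutral_left) (use assms in \<open>auto simp: in_keys_iff\<close>)

lemma eval_monomial_zero [simp]: "eval_monomial s 0 = 1"
  by (simp add: eval_monomial_def)

lemma eval_monomial_add: "eval_monomial s (a + b) = eval_monomial s a * eval_monomial s b"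
proof -
  let ?X = "Poly_Mapping.keys a \<union> Poly_Mapping.keys b"
  have "Poly_Mapping.keys (a + b) \<subseteq> ?X" by (rule Poly_Mapping.keys_add)
  then show ?thesis
    by (simp add: eval_monomial_superset[of ?X] lookup_add power_add prod.distrib)
qed

lemma eval_monomial_single [simp]: "eval_monomial s (Poly_Mapping.single i e) = s i ^ e"
  by (simp add: eval_monomial_def)

lemma poly_eq_sum_singles:
  "p = (\<Sum>a \<in> Poly_Mapping.keys p. Poly_Mapping.single a (Poly_Mapping.lookup p a))"
proof (rule poly_mapping_eqI)
  fix k
  have "(\<Sum>a \<in> Poly_Mapping.keys p. Poly_Mapping.lookup (Poly_Mapping.single a (Poly_Mapping.lookup p a)) k)
      = (\<Sum>a \<in> Poly_Mapping.keys p. if a = k then Poly_Mapping.lookup p k else 0)"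
    by (rule sum.cong) (auto simp: lookup_single)
  also have "\<dots> = Poly_Mapping.lookup p k" by (simp add: in_keys_iff)
  finally show "Poly_Mapping.lookup p k = Poly_Mapping.lookup
     (\<Sum>a \<in> Poly_Mapping.keys p. Poly_Mapping.single a (Poly_Mapping.lookup p a)) k"
    by (simp add: lookup_sum)
qed

lemma Const_zero [simp]: "Const 0 = 0"
  and Const_one [simp]: "Const 1 = 1"
  and Const_add: "Const (c + d) = Const c + Const d"
  and Const_mult: "Const (c * d) = Const c * Const d"
  by (simp_all add: Const_def single_add mult_single)

lemma subst_zero [simp]: "subst s 0 = 0"
  by (simp add: subst_def)

lemma subst_add: "subst s (p + q) = subst s p + subst s q"
  unfolding subst_def
  by (rule setsum_keys_plus_distrib) (simp_all add: Const_add distrib_right)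

lemma subst_sum: "subst s (sum p A) = (\<Sum>x\<in>A. subst s (p x))"
  by (induction A rule: infinite_finite_induct) (simp_all add: subst_add)

lemma subst_single: "subst s (Poly_Mapping.single a c) = Const c * eval_monomial s a"
  by (simp add: subst_def)

lemma subst_mult: "subst s (p * q) = subst s p * subst s q"
proof -
  have mono: "subst s (Poly_Mapping.single a c * Poly_Mapping.single b d)
      = subst s (Poly_Mapping.single a c) * subst s (Poly_Mapping.single b d)" for a b c d
    by (simp add: mult_single subst_single Const_mult eval_monomial_add mult_ac)
  have left: "subst s (p * Poly_Mapping.single b d) = subst s p * subst s (Poly_Mapping.single b d)" for b d
    by (subst (1 2) poly_eq_sum_singles[of p]) (simp only: sum_distrib_right subst_sum mono)
  show ?thesis
    by (subst (1 2) poly_eq_sum_singles[of q]) (simp only: sum_distrib_left subst_sum left)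
qed

lemma subst_Const [simp]: "subst s (Const c) = Const c"
  by (simp add: Const_def subst_single)

lemma subst_one [simp]: "subst s 1 = 1"
  using subst_Const[of s 1] by simp

lemma subst_Var [simp]: "subst s (Var i) = s i"
  by (simp add: Var_def subst_single)

lemma subst_uminus: "subst s (- p) = - subst s p"
  using subst_add[of s "- p" p] by (simp add: eq_neg_iff_add_eq_0)

lemma subst_diff: "subst s (p - q) = subst s p - subst s q"
  using subst_add[of s p "- q"] by (simp add: subst_uminus)

lemma subst_prod: "subst s (prod p A) = (\<Prod>x\<in>A. subst s (p x))"
  by (induction A rule: infinite_finite_induct) (simp_all add: subst_mult)

lemma eval_monomial_Var: "eval_monomial Var a = Poly_Mapping.single a (1::'k::comm_ring_1)"
proof -
  have pow: "Var i ^ e = Poly_Mapping.single (Poly_Mapping.single i e) (1::'k)" for i e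
    by (induction e) (simp_all add: Var_def mult_single flip: single_add)
  have "(\<Prod>i\<in>A. Poly_Mapping.single (g i) (1::'k)) = Poly_Mapping.single (sum g A) 1" for g :: "nat \<Rightarrow> nat \<Rightarrow>\<^sub>0 nat" and A
    by (induction A rule: infinite_finite_induct) (simp_all add: mult_single)
  then show ?thesis
    by (simp add: eval_monomial_def pow) (simp flip: poly_eq_sum_singles)
qed

lemma polys_in_Const [simp]: "Const c \<in> polys_in X"
  by (simp add: polys_in_def Const_def)

lemma polys_in_Var [simp]: "Var i \<in> (polys_in X :: 'k::comm_ring_1 mpoly set) \<longleftrightarrow> i \<in> X"
  by (simp add: polys_in_def Var_def)

lemma polys_in_lookup:
  assumes "p \<in> polys_in X" "a \<in> Poly_Mapping.keys p" "l \<notin> X"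
  shows "Poly_Mapping.lookup a l = 0"
proof -
  have "l \<notin> Poly_Mapping.keys a" using assms by (auto simp: polys_in_def)
  then show ?thesis by (simp add: in_keys_iff)
qed

lemma polys_in_add: "p \<in> polys_in X \<Longrightarrow> q \<in> polys_in X \<Longrightarrow> p + q \<in> polys_in X"
  using Poly_Mapping.keys_add[of p q] unfolding polys_in_def by blast

lemma polys_in_mult:
  assumes "p \<in> polys_in X" "q \<in> polys_in X"
  shows "p * q \<in> polys_in X"
proof -
  have "Poly_Mapping.keys c \<subseteq> X" if c: "c \<in> Poly_Mapping.keys (p * q)" for c
  proof -
    obtain a b where "c = a + b" "a \<in> Poly_Mapping.keys p" "b \<in> Poly_Mapping.keys q"
      using c Poly_Mapping.keys_mult[of p q] by blast
    then show ?thesis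
      using Poly_Mapping.keys_add[of a b] assms unfolding polys_in_def by blast
  qed
  then show ?thesis by (simp add: polys_in_def)
qed

lemma polys_in_mono: "X \<subseteq> Y \<Longrightarrow> p \<in> polys_in X \<Longrightarrow> p \<in> polys_in Y"
  by (auto simp: polys_in_def)

lemma polys_in_uminus: "p \<in> polys_in X \<Longrightarrow> - p \<in> polys_in X"
  by (auto simp: polys_in_def)

lemma single_one_neq_zero [simp]: "Poly_Mapping.single i (Suc 0) \<noteq> 0"
  by (metis lookup_single_eq lookup_zero nat.distinct(1))

text \<open>Polynomials are generated by constants and variables under sums and products, so
  identities between ring homomorphisms need to be tested on generators only.\<close>

lemma polys_in_induct [consumes 1, case_names Const Var add mult]:
  assumes p: "p \<in> polys_in X"
    and const: "\<And>c. P (Const c)"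
    and var: "\<And>i. i \<in> X \<Longrightarrow> P (Var i)"
    and add: "\<And>p q. p \<in> polys_in X \<Longrightarrow> q \<in> polys_in X \<Longrightarrow> P p \<Longrightarrow> P q \<Longrightarrow> P (p + q)"
    and mult: "\<And>p q. p \<in> polys_in X \<Longrightarrow> q \<in> polys_in X \<Longrightarrow> P p \<Longrightarrow> P q \<Longrightarrow> P (p * q)"
  shows "P p"
proof -
  let ?Q = "\<lambda>p. p \<in> polys_in X \<and> P p"
  have Qprod: "?Q (prod g A)" if "\<And>i. i \<in> A \<Longrightarrow> ?Q (g i)" for g :: "nat \<Rightarrow> _" and A
    using that
  proof (induction A rule: infinite_finite_induct)
    case (insert x F) then show ?case by (simp add: mult polys_in_mult)
  qed (use const[of 1] polys_in_Const[of 1 X] in simp_all)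
  have Qsum: "?Q (sum g A)" if "\<And>i. i \<in> A \<Longrightarrow> ?Q (g i)" for g :: "(nat \<Rightarrow>\<^sub>0 nat) \<Rightarrow> _" and A
    using that
  proof (induction A rule: infinite_finite_induct)
    case (insert x F) then show ?case by (simp add: add polys_in_add)
  qed (use const[of 0] polys_in_Const[of 0 X] in simp_all)
  have Qpow: "?Q (Var i ^ e)" if "i \<in> X" for i e
    using that
    by (induction e) (use const[of 1] polys_in_Const[of 1 X] in \<open>simp_all add: mult var polys_in_mult\<close>)
  have mono: "?Q (Poly_Mapping.single a c)" if "a \<in> Poly_Mapping.keys p" for a c
  proof -
    have "Poly_Mapping.keys a \<subseteq> X" using that p by (auto simp: polys_in_def)
    then have "?Q (eval_monomial Var a)"
      unfolding eval_monomial_def by (intro Qprod Qpow) auto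
    then have "?Q (Const c * eval_monomial Var a)"
      by (simp add: mult const polys_in_mult)
    then show ?thesis by (simp add: eval_monomial_Var Const_def mult_single)
  qed
  have "?Q p"
    by (subst (1 2) poly_eq_sum_singles[of p]) (intro Qsum mono)
  then show ?thesis ..
qed

lemma polys_in_UNIV [simp]: "p \<in> polys_in UNIV"
  by (simp add: polys_in_def)

lemma polys_in_subst:
  assumes "p \<in> polys_in X" "\<And>i. i \<in> X \<Longrightarrow> s i \<in> polys_in Y"
  shows "subst s p \<in> polys_in Y"
  using assms(1)
  by (induction rule: polys_in_induct)
     (use assms(2) in \<open>auto simp: subst_add subst_mult polys_in_add polys_in_mult\<close>)

lemma subst_cong:
  assumes "p \<in> polys_in X" "\<And>i. i \<in> X \<Longrightarrow> s i = s' i"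
  shows "subst s p = subst s' p"
  using assms(1)
  by (induction rule: polys_in_induct) (use assms(2) in \<open>auto simp: subst_add subst_mult\<close>)

lemma subst_subst: "subst s (subst s' p) = subst (\<lambda>i. subst s (s' i)) p"
  using polys_in_UNIV[of p]
  by (induction rule: polys_in_induct) (auto simp: subst_add subst_mult)

lemma subst_Var_id [simp]: "subst Var p = p"
  using polys_in_UNIV[of p]
  by (induction rule: polys_in_induct) (auto simp: subst_add subst_mult)

lemma automorphism_eq_subst:
  assumes "algebra_automorphism m F" "p \<in> polys m"
  shows "F p = subst (\<lambda>i. F (Var i)) p"
  using assms(2) unfolding polys_eq_polys_in
  by (induction rule: polys_in_induct)
     (use assms(1) in \<open>auto simp: algebra_automorphism_def subst_add subst_mult polys_eq_polys_in\<close>)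

text \<open>Modulo \<open>f\<close> all variables become zero, so only the constant term survives. This is how a
  variable will be shown to be a constant plus a multiple of a coordinate.\<close>

lemma subst_multiples:
  assumes "\<And>i. f dvd s i"
  shows "\<exists>c r. subst s p = Const c + f * r"
  using polys_in_UNIV[of p]
proof (induction rule: polys_in_induct)
  case (Const c) show ?case by (intro exI[of _ c] exI[of _ 0]) simp
next
  case (Var i)
  obtain r where "s i = f * r" using assms[of i] by (elim dvdE)
  then show ?case by (intro exI[of _ 0] exI[of _ r]) simp
next
  case (add p q)
  then obtain c r c' r' where "subst s p = Const c + f * r" "subst s q = Const c' + f * r'" by blast
  then show ?case
    by (intro exI[of _ "c + c'"] exI[of _ "r + r'"]) (simp add: subst_add Const_add algebra_simps)
next
  case (mult p q)
  then obtain c r c' r' where "subst s p = Const c + f * r" "subst s q = Const c' + f * r'" by blast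
  then show ?case
    by (intro exI[of _ "c * c'"] exI[of _ "Const c * r' + r * Const c' + f * r * r'"])
       (simp add: subst_mult Const_mult algebra_simps)
qed

definition set_to_zero :: "nat \<Rightarrow> 'k::comm_ring_1 mpoly \<Rightarrow> 'k mpoly" where
  "set_to_zero v = subst (Var(v := 0))"

lemma lookup_set_to_zero:
  "Poly_Mapping.lookup (set_to_zero v p) b = (if Poly_Mapping.lookup b v = 0 then Poly_Mapping.lookup p b else 0)"
proof -
  have mono: "set_to_zero v (Poly_Mapping.single a c) = (if Poly_Mapping.lookup a v = 0 then Poly_Mapping.single a c else 0)"
    for a and c :: "'a"
  proof (cases "Poly_Mapping.lookup a v = 0")
    case True
    then have "eval_monomial (Var(v := 0)) a = (eval_monomial Var a :: 'a mpoly)"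
      unfolding eval_monomial_def by (intro prod.cong) (auto simp: in_keys_iff)
    then show ?thesis
      using True by (simp add: set_to_zero_def subst_single eval_monomial_Var Const_def mult_single del: fun_upd_apply)
  next
    case False
    then have "eval_monomial (Var(v := 0)) a = (0 :: 'a mpoly)"
      unfolding eval_monomial_def by (intro prod_zero) (auto simp: in_keys_iff zero_power intro!: bexI[of _ v])
    then show ?thesis
      using False by (simp add: set_to_zero_def subst_single)
  qed
  have "set_to_zero v p = (\<Sum>a \<in> Poly_Mapping.keys p. set_to_zero v (Poly_Mapping.single a (Poly_Mapping.lookup p a)))"
    by (subst (1) poly_eq_sum_singles[of p]) (simp only: set_to_zero_def subst_sum)
  also have "Poly_Mapping.lookup \<dots> b = (\<Sum>a \<in> Poly_Mapping.keys p. if a = b then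
      (if Poly_Mapping.lookup b v = 0 then Poly_Mapping.lookup p b else 0) else 0)"
    unfolding lookup_sum mono by (intro sum.cong) (auto simp: lookup_single)
  also have "\<dots> = (if Poly_Mapping.lookup b v = 0 then Poly_Mapping.lookup p b else 0)"
    by (auto simp: in_keys_iff)
  finally show ?thesis .
qed


section \<open>Multiples in an ordered group\<close>

lemma nat_times_zero [simp]: "0 \<cdot> g = 0"
  and nat_times_Suc: "Suc e \<cdot> g = g + e \<cdot> g"
  by (simp_all add: nat_times_def add.commute)

lemma nat_times_one [simp]: "Suc 0 \<cdot> g = g"
  by (simp add: nat_times_Suc)

lemma nat_times_zero_right [simp]: "e \<cdot> 0 = 0"
  by (simp add: nat_times_def)

lemma nat_times_add_left: "(a + b) \<cdot> g = a \<cdot> g + b \<cdot> g"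
  by (induction a) (simp_all add: nat_times_Suc add.assoc)

lemma nat_times_add_right: "a \<cdot> (g + h) = a \<cdot> g + a \<cdot> h"
  by (simp add: nat_times_def sum.distrib)

lemma nat_times_diff: "a \<cdot> (g - h) = a \<cdot> g - a \<cdot> (h::'g::ab_group_add)"
  by (simp add: nat_times_def sum_subtractf)

lemma nat_times_mult: "(a * b) \<cdot> g = a \<cdot> (b \<cdot> g)"
  by (induction a) (simp_all add: nat_times_Suc nat_times_add_left)

lemma nat_times_sum: "a \<cdot> sum g A = (\<Sum>x\<in>A. a \<cdot> g x)"
  by (induction A rule: infinite_finite_induct) (simp_all add: nat_times_add_right)

lemma nat_times_mono: "g \<le> h \<Longrightarrow> a \<cdot> g \<le> a \<cdot> (h::'g::linordered_ab_group_add)"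
  by (simp add: nat_times_def sum_mono)

lemma nat_times_strict_mono: "g < h \<Longrightarrow> 0 < a \<Longrightarrow> a \<cdot> g < a \<cdot> (h::'g::linordered_ab_group_add)"
  unfolding nat_times_def by (rule sum_strict_mono) auto

lemma nat_times_nonneg: "0 \<le> g \<Longrightarrow> 0 \<le> a \<cdot> (g::'g::linordered_ab_group_add)"
  by (simp add: nat_times_def sum_nonneg)

lemma nat_times_ge: "0 \<le> g \<Longrightarrow> 0 < a \<Longrightarrow> g \<le> a \<cdot> (g::'g::linordered_ab_group_add)"
  by (cases a) (auto simp: nat_times_Suc nat_times_nonneg)

section \<open>Monomial orders refining a weight\<close>

text \<open>A monomial order is obtained by comparing an additive weight first, then the exponent of a
  distinguished variable, and finally breaking ties by the lexicographic order on exponent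
  vectors. The ties must be broken because several monomials of equal weight and \<open>z\<close>-exponent may
  occur; a unique leading monomial makes leading monomials multiplicative over a domain.\<close>

locale weighted_order =
  fixes v :: "(nat \<Rightarrow>\<^sub>0 nat) \<Rightarrow> 'g::linordered_ab_group_add" and z :: nat
  assumes weight_add: "v (a + b) = v a + v b"
begin

lemma weight_zero [simp]: "v 0 = 0"
  using weight_add[of 0 0] by simp

lemma weight_sum: "v (sum l A) = (\<Sum>x\<in>A. v (l x))"
  by (induction A rule: infinite_finite_induct) (simp_all add: weight_add)

lemma weight_single: "v (Poly_Mapping.single i e) = e \<cdot> v (Poly_Mapping.single i 1)"
proof (induction e)
  case (Suc e)
  have "Poly_Mapping.single i (Suc e) = Poly_Mapping.single i 1 + Poly_Mapping.single i e"
    by (simp flip: single_add)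
  then show ?case using Suc by (simp add: weight_add nat_times_Suc)
qed simp

lemma weight_expand:
  "v a = (\<Sum>i \<in> Poly_Mapping.keys a. Poly_Mapping.lookup a i \<cdot> v (Poly_Mapping.single i 1))"
  by (subst poly_eq_sum_singles[of a], subst weight_sum) (intro sum.cong refl weight_single)

definition mono_less :: "(nat \<Rightarrow>\<^sub>0 nat) \<Rightarrow> (nat \<Rightarrow>\<^sub>0 nat) \<Rightarrow> bool" where
  "mono_less a b \<longleftrightarrow> v a < v b \<or> v a = v b \<and>
     (Poly_Mapping.lookup a z < Poly_Mapping.lookup b z \<or>
      Poly_Mapping.lookup a z = Poly_Mapping.lookup b z \<and> a < b)"

lemma mono_less_irrefl: "\<not> mono_less a a"
  and mono_less_trans: "mono_less a b \<Longrightarrow> mono_less b c \<Longrightarrow> mono_less a c"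
  and mono_less_total: "a = b \<or> mono_less a b \<or> mono_less b a"
  by (auto simp: mono_less_def)

lemma mono_less_add: "mono_less a b \<Longrightarrow> mono_less (a + c) (b + c)"
  by (auto simp: mono_less_def weight_add lookup_add)

lemma mono_less_add_both:
  assumes "a = a' \<or> mono_less a a'" "b = b' \<or> mono_less b b'"
  shows "a = a' \<and> b = b' \<or> mono_less (a + b) (a' + b')"
  using assms mono_less_add[of a a' b] mono_less_add[of b b' a'] mono_less_trans
  by (auto simp: add.commute)

definition leading :: "'k::comm_ring_1 mpoly \<Rightarrow> (nat \<Rightarrow>\<^sub>0 nat) \<Rightarrow> bool" where
  "leading p a \<longleftrightarrow> a \<in> Poly_Mapping.keys p \<and>
     (\<forall>b \<in> Poly_Mapping.keys p. b = a \<or> mono_less b a)"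

lemma leading_in_keys: "leading p a \<Longrightarrow> a \<in> Poly_Mapping.keys p"
  by (simp add: leading_def)

lemma leading_weight: "leading p a \<Longrightarrow> b \<in> Poly_Mapping.keys p \<Longrightarrow> v b \<le> v a"
  by (auto simp: leading_def mono_less_def)

lemma leading_exponent:
  "leading p a \<Longrightarrow> b \<in> Poly_Mapping.keys p \<Longrightarrow> v b = v a \<Longrightarrow>
     Poly_Mapping.lookup b z \<le> Poly_Mapping.lookup a z"
  by (auto simp: leading_def mono_less_def)

lemma ex_leading:
  assumes "p \<noteq> 0"
  shows "\<exists>a. leading p a"
proof -
  have "\<exists>a\<in>A. \<forall>b\<in>A. b = a \<or> mono_less b a" if "finite A" "A \<noteq> {}" for A
    using that
  proof (induction A rule: finite_ne_induct)
    case (insert x A)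
    then obtain a where a: "a \<in> A" "\<forall>b\<in>A. b = a \<or> mono_less b a" by blast
    show ?case
    proof (cases "mono_less a x")
      case True
      then show ?thesis using a mono_less_trans by (intro bexI[of _ x]) auto
    next
      case False
      then show ?thesis using a mono_less_total[of a x] by (intro bexI[of _ a]) auto
    qed
  qed simp
  from this[of "Poly_Mapping.keys p"] show ?thesis
    using assms by (auto simp: leading_def)
qed

text \<open>The product of the leading terms cannot cancel: no other pair of monomials has the
  same sum as the two leading ones.\<close>

lemma leading_mult:
  fixes p q :: "'k::idom mpoly"
  assumes p: "leading p a" and q: "leading q b"
  shows "leading (p * q) (a + b)"
proof -
  have unique: "x = a \<and> y = b \<or> mono_less (x + y) (a + b)"
    if "x \<in> Poly_Mapping.keys p" "y \<in> Poly_Mapping.keys q" for x y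
  proof -
    have "x = a \<or> mono_less x a" "y = b \<or> mono_less y b"
      using that p q unfolding leading_def by blast+
    then show ?thesis by (rule mono_less_add_both)
  qed
  let ?A = "Poly_Mapping.keys p" and ?B = "Poly_Mapping.keys q"
  let ?t = "\<lambda>x y. Poly_Mapping.lookup p x * Poly_Mapping.lookup q y"
  have "p * q = (\<Sum>x\<in>?A. \<Sum>y\<in>?B. Poly_Mapping.single (x + y) (?t x y))"
    by (subst poly_eq_sum_singles[of p], subst poly_eq_sum_singles[of q])
       (simp only: sum_product mult_single)
  then have "Poly_Mapping.lookup (p * q) (a + b)
      = (\<Sum>x\<in>?A. \<Sum>y\<in>?B. Poly_Mapping.lookup (Poly_Mapping.single (x + y) (?t x y)) (a + b))"
    by (simp add: lookup_sum)
  also have "\<dots> = (\<Sum>x\<in>?A. \<Sum>y\<in>?B. if x = a then (if y = b then ?t a b else 0) else 0)"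
  proof (intro sum.cong refl)
    fix x y assume "x \<in> ?A" "y \<in> ?B"
    with unique[of x y] show "Poly_Mapping.lookup (Poly_Mapping.single (x + y) (?t x y)) (a + b)
        = (if x = a then (if y = b then ?t a b else 0) else 0)"
      using mono_less_irrefl[of "a + b"] by (auto simp: lookup_single when_def)
  qed
  also have "\<dots> = (\<Sum>x\<in>?A. if x = a then ?t a b else 0)"
    using leading_in_keys[OF q] by (intro sum.cong) auto
  also have "\<dots> = ?t a b"
    using leading_in_keys[OF p] by simp
  finally have "Poly_Mapping.lookup (p * q) (a + b) \<noteq> 0"
    using leading_in_keys[OF p] leading_in_keys[OF q] by (simp add: in_keys_iff)
  moreover have "c = a + b \<or> mono_less c (a + b)" if "c \<in> Poly_Mapping.keys (p * q)" for c
    using that Poly_Mapping.keys_mult[of p q] unique by blast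
  ultimately show ?thesis by (simp add: leading_def in_keys_iff)
qed

lemma leading_prod:
  fixes p :: "'i \<Rightarrow> 'k::idom mpoly"
  assumes "\<And>i. i \<in> A \<Longrightarrow> leading (p i) (l i)"
  shows "leading (prod p A) (sum l A)"
  using assms
proof (induction A rule: infinite_finite_induct)
  case (insert x F) then show ?case by (simp add: leading_mult)
qed (simp_all add: leading_def)

definition weight_le :: "'k::comm_ring_1 mpoly \<Rightarrow> 'g \<Rightarrow> bool" where
  "weight_le p c \<longleftrightarrow> (\<forall>b \<in> Poly_Mapping.keys p. v b \<le> c)"

lemma weight_le_one: "weight_le 1 0"
  by (simp add: weight_le_def)

lemma weight_le_Const: "weight_le (Const c) 0"
  by (simp add: weight_le_def Const_def)

lemma weight_le_mult: "weight_le p c \<Longrightarrow> weight_le q d \<Longrightarrow> weight_le (p * q) (c + d)"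
  using Poly_Mapping.keys_mult[of p q] unfolding weight_le_def
  by (fastforce simp: weight_add intro: add_mono)

lemma weight_le_power: "weight_le p c \<Longrightarrow> weight_le (p ^ e) (e \<cdot> c)"
  by (induction e) (simp_all add: weight_le_one weight_le_mult nat_times_Suc)

lemma weight_le_prod: "(\<And>i. i \<in> A \<Longrightarrow> weight_le (p i) (c i)) \<Longrightarrow> weight_le (prod p A) (sum c A)"
  by (induction A rule: infinite_finite_induct) (simp_all add: weight_le_one weight_le_mult)

lemma weight_le_eval_monomial:
  assumes "\<And>i. i \<in> Poly_Mapping.keys a \<Longrightarrow> weight_le (s i) (c i)"
  shows "weight_le (eval_monomial s a) (\<Sum>i \<in> Poly_Mapping.keys a. Poly_Mapping.lookup a i \<cdot> c i)"
  unfolding eval_monomial_def using assms by (intro weight_le_prod weight_le_power)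

end

section \<open>Homomorphisms fixing a polynomial\<close>

text \<open>Giving the variable \<open>z\<close> weight \<open>- \<gamma> / N\<close> with the largest slope \<open>\<gamma> / N\<close> of
  \<open>(W b - W x\<^sub>i) / (exponent of z in b)\<close> is what makes every \<open>s i\<close> that specialises to \<open>x\<^sub>i\<close> at
  \<open>z = 0\<close> have the same weight as \<open>x\<^sub>i\<close>, with a monomial divisible by \<open>z\<close> of that weight in at least one of them. The group need not be
  divisible, so all weights are multiplied by a common denominator \<open>N\<close> of the slopes.\<close>

lemma steepest_slope:
  fixes s :: "nat \<Rightarrow> 'k::idom mpoly" and W :: "(nat \<Rightarrow>\<^sub>0 nat) \<Rightarrow> 'g::linordered_ab_group_add"
  assumes "finite I" "j \<in> I" "b \<in> Poly_Mapping.keys (s j)" "Poly_Mapping.lookup b z \<noteq> 0"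
  obtains N :: nat and \<gamma> i0 b0 where "N > 0"
    and "\<And>i b. i \<in> I \<Longrightarrow> b \<in> Poly_Mapping.keys (s i) \<Longrightarrow> Poly_Mapping.lookup b z \<noteq> 0 \<Longrightarrow>
        N \<cdot> (W b - W (Poly_Mapping.single i 1)) \<le> Poly_Mapping.lookup b z \<cdot> \<gamma>"
    and "i0 \<in> I" "b0 \<in> Poly_Mapping.keys (s i0)" "Poly_Mapping.lookup b0 z \<noteq> 0"
      "N \<cdot> (W b0 - W (Poly_Mapping.single i0 1)) = Poly_Mapping.lookup b0 z \<cdot> \<gamma>"
proof -
  define T where "T = {(i, b) \<in> Sigma I (\<lambda>i. Poly_Mapping.keys (s i)). Poly_Mapping.lookup b z \<noteq> 0}"
  have fin: "finite T"
    unfolding T_def using assms(1) by (intro finite_subset[OF _ finite_SigmaI[of I "\<lambda>i. Poly_Mapping.keys (s i)"]]) auto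
  have "T \<noteq> {}" using assms by (auto simp: T_def)
  define N where "N = (\<Prod>(i, b) \<in> T. Poly_Mapping.lookup b z)"
  have "N > 0" unfolding N_def by (intro prod_pos) (auto simp: T_def)
  have dvd: "Poly_Mapping.lookup b z dvd N" if "(i, b) \<in> T" for i b
    using dvd_prodI[OF fin that, of "\<lambda>(i, b). Poly_Mapping.lookup b z"] by (simp add: N_def)
  define slope where "slope = (\<lambda>(i, b). (N div Poly_Mapping.lookup b z) \<cdot> (W b - W (Poly_Mapping.single i 1)))"
  have slope: "Poly_Mapping.lookup b z \<cdot> slope (i, b) = N \<cdot> (W b - W (Poly_Mapping.single i 1))"
    if "(i, b) \<in> T" for i b
    using dvd[OF that] by (simp add: slope_def flip: nat_times_mult)
  have "Max (slope ` T) \<in> slope ` T" using fin \<open>T \<noteq> {}\<close> by (intro Max_in) auto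
  then obtain i0 b0 where max: "(i0, b0) \<in> T" "Max (slope ` T) = slope (i0, b0)" by auto
  have le: "slope (i, b) \<le> Max (slope ` T)" if "(i, b) \<in> T" for i b
    using fin that by (intro Max_ge) auto
  show thesis
  proof (rule that[of N "Max (slope ` T)" i0 b0])
    fix i b assume "i \<in> I" "b \<in> Poly_Mapping.keys (s i)" "Poly_Mapping.lookup b z \<noteq> 0"
    then have "(i, b) \<in> T" by (simp add: T_def)
    then show "N \<cdot> (W b - W (Poly_Mapping.single i 1)) \<le> Poly_Mapping.lookup b z \<cdot> Max (slope ` T)"
      using slope[of i b] nat_times_mono[OF le[of i b]] by metis
  next
    show "N \<cdot> (W b0 - W (Poly_Mapping.single i0 1)) = Poly_Mapping.lookup b0 z \<cdot> Max (slope ` T)"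
      using slope[OF max(1)] by (simp only: max(2))
  qed (use \<open>N > 0\<close> max(1) in \<open>simp_all add: T_def\<close>)
qed

text \<open>Read contrapositively: if all \<open>x\<^sub>i\<close> with \<open>i \<in> I\<close> divide the leading form of a polynomial
  fixed by \<open>s\<close>, then \<open>s\<close> fixes all these \<open>x\<^sub>i\<close>. Write the leading form as
  the product of the \<open>x\<^sub>i\<close> times \<open>g\<close>, and weigh \<open>z\<close> as in \<open>steepest_slope\<close>. The leading monomial
  of the image of this product is the product of the leading monomials of the \<open>s i\<close> and of the
  image of \<open>g\<close>. It is divisible by \<open>z\<close>, since one of its factors is, and it is too heavy to be
  cancelled by the images of the remaining terms of \<open>f\<close>. So \<open>z\<close> would occur in \<open>f\<close>.\<close>

lemma subst_fixing_fixes_leading_factors: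
  fixes s :: "nat \<Rightarrow> 'k::idom mpoly" and W :: "(nat \<Rightarrow>\<^sub>0 nat) \<Rightarrow> 'g::linordered_ab_group_add"
  assumes W_add: "\<And>a b. W (a + b) = W a + W b"
    and I: "finite I" "z \<notin> I"
    and f: "f \<in> polys_in I" "subst s f = f"
    and set_to_zero: "\<And>i. i \<in> I \<Longrightarrow> set_to_zero z (s i) = Var i"
    and moved: "j \<in> I" "b \<in> Poly_Mapping.keys (s j)" "Poly_Mapping.lookup b z \<noteq> 0"
    and top: "a0 \<in> Poly_Mapping.keys f" "\<And>a. a \<in> Poly_Mapping.keys f \<Longrightarrow> W a \<le> W a0"
  shows "\<exists>a \<in> Poly_Mapping.keys f. W a = W a0 \<and> (\<exists>i \<in> I. Poly_Mapping.lookup a i = 0)"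
proof (rule ccontr)
  assume "\<not> ?thesis"
  then have full: "Poly_Mapping.lookup a i \<noteq> 0" if "a \<in> Poly_Mapping.keys f" "W a = W a0" "i \<in> I" for a i
    using that by (simp add: Bex_def)
  define e :: "nat \<Rightarrow> nat \<Rightarrow>\<^sub>0 nat" where "e i = Poly_Mapping.single i 1" for i
  obtain N \<gamma> i0 b0 where "N > 0"
    and slope: "\<And>i b. i \<in> I \<Longrightarrow> b \<in> Poly_Mapping.keys (s i) \<Longrightarrow> Poly_Mapping.lookup b z \<noteq> 0 \<Longrightarrow>
        N \<cdot> (W b - W (Poly_Mapping.single i 1)) \<le> Poly_Mapping.lookup b z \<cdot> \<gamma>"
    and b0: "i0 \<in> I" "b0 \<in> Poly_Mapping.keys (s i0)" "Poly_Mapping.lookup b0 z \<noteq> 0"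
      "N \<cdot> (W b0 - W (Poly_Mapping.single i0 1)) = Poly_Mapping.lookup b0 z \<cdot> \<gamma>"
    by (rule steepest_slope[where s = s and W = W and z = z, OF I(1) moved]) (rule that, assumption+)
  interpret W: weighted_order W z
    by unfold_locales (rule W_add)
  define v where "v = (\<lambda>a. N \<cdot> W a - Poly_Mapping.lookup a z \<cdot> \<gamma>)"
  interpret weighted_order v z
    by unfold_locales (simp add: v_def W_add lookup_add nat_times_add_left nat_times_add_right)
  (* The slope bound says that s does not raise the weight of a variable in I. *)
  have v_le: "v b \<le> N \<cdot> W (e i)" if "i \<in> I" "b \<in> Poly_Mapping.keys (s i)" for i b
  proof (cases "Poly_Mapping.lookup b z = 0")
    case True
    then have "Poly_Mapping.lookup (Var i :: 'k mpoly) b = Poly_Mapping.lookup (s i) b"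
      using set_to_zero[OF that(1)] lookup_set_to_zero[of z "s i" b] by simp
    then have "b = e i"
      using that(2) by (auto simp: Var_def e_def lookup_single in_keys_iff when_def split: if_splits)
    then show ?thesis using True by (simp add: v_def)
  next
    case False
    from slope[OF that False] show ?thesis by (simp add: v_def e_def nat_times_diff algebra_simps)
  qed
  have v_b0: "v b0 = N \<cdot> W (e i0)"
    using b0(4) by (simp add: v_def e_def nat_times_diff algebra_simps)
  have e_key: "e i \<in> Poly_Mapping.keys (s i)" and v_e: "v (e i) = N \<cdot> W (e i)" if "i \<in> I" for i
  proof -
    have z: "Poly_Mapping.lookup (e i) z = 0"
      using I(2) that by (auto simp: e_def lookup_single when_def)
    then have "Poly_Mapping.lookup (s i) (e i) = 1"
      using set_to_zero[OF that] lookup_set_to_zero[of z "s i" "e i"] by (simp add: Var_def e_def)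
    then show "e i \<in> Poly_Mapping.keys (s i)" by (simp add: in_keys_iff)
    show "v (e i) = N \<cdot> W (e i)" using z by (simp add: v_def)
  qed
  have "\<exists>l. leading (s i) l" if "i \<in> I" for i
    using e_key[OF that] by (intro ex_leading) auto
  then obtain l where l: "\<And>i. i \<in> I \<Longrightarrow> leading (s i) (l i)" by metis
  have v_l: "v (l i) = N \<cdot> W (e i)" if "i \<in> I" for i
    using v_le[OF that leading_in_keys[OF l[OF that]]] leading_weight[OF l[OF that] e_key[OF that]] v_e[OF that]
    by simp
  (* b0 has maximal weight in s i0, and ties are broken by the exponent of z. *)
  have l_i0: "Poly_Mapping.lookup (l i0) z > 0"
    using leading_exponent[OF l[OF b0(1)] b0(2)] v_b0 v_l[OF b0(1)] b0(3) by simp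
  define u where "u = sum e I"
  define Top where "Top = {a \<in> Poly_Mapping.keys f. W a = W a0}"
  define g where "g = (\<Sum>a \<in> Top. Poly_Mapping.single (a - u) (Poly_Mapping.lookup f a))"
  define h where "h = (\<Sum>a \<in> Poly_Mapping.keys f - Top. Poly_Mapping.single a (Poly_Mapping.lookup f a))"
  have lookup_u: "Poly_Mapping.lookup u i = (if i \<in> I then 1 else 0)" for i
    using I(1) by (simp add: u_def e_def lookup_sum lookup_single when_def)
  have u_add: "u + (a - u) = a" if "a \<in> Top" for a
  proof (rule poly_mapping_eqI)
    fix i
    show "Poly_Mapping.lookup (u + (a - u)) i = Poly_Mapping.lookup a i"
      using full[of a i] that by (auto simp: Top_def lookup_add lookup_minus lookup_u)
  qed
  have prod_Var: "(\<Prod>i\<in>I. Var i) = (Poly_Mapping.single u 1 :: 'k mpoly)"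
  proof -
    have "(\<Prod>i\<in>A. Var i) = (Poly_Mapping.single (sum e A) 1 :: 'k mpoly)" for A
      by (induction A rule: infinite_finite_induct) (simp_all add: Var_def e_def mult_single)
    then show ?thesis by (simp add: u_def)
  qed
  have split: "f = (\<Prod>i\<in>I. Var i) * g + h"
  proof -
    have "(\<Prod>i\<in>I. Var i) * g = (\<Sum>a \<in> Top. Poly_Mapping.single a (Poly_Mapping.lookup f a))"
      unfolding prod_Var g_def sum_distrib_left by (intro sum.cong) (simp_all add: mult_single u_add)
    then show ?thesis
      unfolding h_def by (subst poly_eq_sum_singles[of f], subst sum.subset_diff[of Top]) (auto simp: Top_def add.commute)
  qed
  have key_I: "Poly_Mapping.keys a \<subseteq> I" if "a \<in> Poly_Mapping.keys f" for a
    using f(1) that by (auto simp: polys_in_def)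
  have g_keys: "\<exists>a\<in>Top. c = a - u" if "c \<in> Poly_Mapping.keys g" for c
    using that Poly_Mapping.keys_sum[of "\<lambda>a. Poly_Mapping.single (a - u) (Poly_Mapping.lookup f a)" Top]
    unfolding g_def by (auto split: if_splits)
  have "g \<in> polys_in I"
    using g_keys key_I by (fastforce simp: polys_in_def Top_def in_keys_iff lookup_minus)
  have "g \<noteq> 0"
  proof
    assume "g = 0"
    then have "a0 \<in> Poly_Mapping.keys h" using split top(1) by simp
    then show False
      using Poly_Mapping.keys_sum[of "\<lambda>a. Poly_Mapping.single a (Poly_Mapping.lookup f a)" "Poly_Mapping.keys f - Top"] top(1)
      by (auto simp: h_def Top_def split: if_splits)
  qed
  then obtain c where c: "c \<in> Poly_Mapping.keys g" by (meson equals0I keys_eq_empty)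
  obtain a where a: "a \<in> Top" "c = a - u" using g_keys[OF c] by blast
  have c_z: "Poly_Mapping.lookup c z = 0"
    using polys_in_lookup[OF \<open>g \<in> polys_in I\<close> c I(2)] .
  (* The part of subst s g at z = 0 is g, so the image of g is at least as heavy as g. *)
  have "set_to_zero z (subst s g) = subst (\<lambda>i. set_to_zero z (s i)) g"
    by (simp add: set_to_zero_def subst_subst)
  also have "\<dots> = g"
    using subst_cong[OF \<open>g \<in> polys_in I\<close>, of "\<lambda>i. set_to_zero z (s i)" Var] set_to_zero by simp
  finally have "c \<in> Poly_Mapping.keys (subst s g)"
    using c c_z lookup_set_to_zero[of z "subst s g" c] by (simp add: in_keys_iff)
  then obtain \<nu> where \<nu>: "leading (subst s g) \<nu>" "v c \<le> v \<nu>"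
    using ex_leading[of "subst s g"] leading_weight by fastforce
  define \<mu> where "\<mu> = sum l I + \<nu>"
  have "leading (\<Prod>i\<in>I. s i) (sum l I)" using l by (rule leading_prod)
  then have \<mu>: "leading (subst s ((\<Prod>i\<in>I. Var i) * g)) \<mu>"
    unfolding \<mu>_def using \<nu>(1) by (simp add: subst_mult subst_prod leading_mult)
  have "N \<cdot> W a0 = N \<cdot> W (u + c)" using a u_add[of a] by (simp add: Top_def)
  also have "\<dots> = (\<Sum>i\<in>I. v (l i)) + v c"
    using c_z v_l by (simp add: v_def u_def W_add W.weight_sum nat_times_add_right nat_times_sum)
  also have "\<dots> \<le> v \<mu>" using \<nu>(2) by (simp add: \<mu>_def weight_add weight_sum)
  finally have v_\<mu>: "N \<cdot> W a0 \<le> v \<mu>" .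
  have "\<mu> \<notin> Poly_Mapping.keys (subst s h)"
  proof
    assume "\<mu> \<in> Poly_Mapping.keys (subst s h)"
    then obtain a where a: "a \<in> Poly_Mapping.keys f - Top"
      "\<mu> \<in> Poly_Mapping.keys (Const (Poly_Mapping.lookup f a) * eval_monomial s a)"
      using Poly_Mapping.keys_sum[of "\<lambda>a. Const (Poly_Mapping.lookup f a) * eval_monomial s a" "Poly_Mapping.keys f - Top"]
      unfolding h_def subst_sum subst_single by blast
    have "weight_le (eval_monomial s a) (\<Sum>i \<in> Poly_Mapping.keys a. Poly_Mapping.lookup a i \<cdot> (N \<cdot> W (e i)))"
      using key_I a(1) v_le by (intro weight_le_eval_monomial) (auto simp: weight_le_def)
    moreover have "(\<Sum>i \<in> Poly_Mapping.keys a. Poly_Mapping.lookup a i \<cdot> (N \<cdot> W (e i))) = N \<cdot> W a"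
      by (subst (2) W.weight_expand) (simp add: e_def nat_times_sum mult.commute flip: nat_times_mult)
    ultimately have "weight_le (Const (Poly_Mapping.lookup f a) * eval_monomial s a) (N \<cdot> W a)"
      using weight_le_mult[OF weight_le_Const] by fastforce
    then have "v \<mu> \<le> N \<cdot> W a" using a(2) by (simp add: weight_le_def)
    moreover have "W a < W a0" using a(1) top(2)[of a] by (auto simp: Top_def)
    ultimately show False using v_\<mu> nat_times_strict_mono[of "W a" "W a0" N] \<open>N > 0\<close> by simp
  qed
  moreover have "f = subst s ((\<Prod>i\<in>I. Var i) * g) + subst s h"
    using f(2) split by (metis subst_add)
  ultimately have "\<mu> \<in> Poly_Mapping.keys f"
    using leading_in_keys[OF \<mu>] by (metis add.right_neutral in_keys_iff lookup_add)
  then have "Poly_Mapping.lookup \<mu> z = 0"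
    using polys_in_lookup[OF f(1) _ I(2)] by blast
  moreover have "Poly_Mapping.lookup (sum l I) z \<ge> Poly_Mapping.lookup (l i0) z"
    unfolding lookup_sum using I(1) b0(1) by (intro member_le_sum) auto
  ultimately show False using l_i0 by (simp add: \<mu>_def lookup_add)
qed


section \<open>Coordinates\<close>

text \<open>Variables are indexed from 1, so \<open>Var 0\<close> is free to serve as the deformation parameter
  \<open>t\<close>. With \<open>g\<close> the images of the variables under the inverse of \<open>F\<close>, the deformation \<open>\<psi>\<close> sends
  \<open>x\<^sub>l\<close> to \<open>s l\<close>. Since \<open>f\<close> is \<open>F(x\<^sub>j)\<close> and the scaling leaves \<open>x\<^sub>j\<close> alone, \<open>\<psi>\<close> fixes \<open>f\<close>; it
  must then fix \<open>x\<^sub>i\<close>, and specialising \<open>t\<close> to \<open>-1\<close> exhibits \<open>x\<^sub>i\<close> as a polynomial in \<open>f\<close>.\<close>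

lemma coordinate_leading_monomials:
  fixes F :: "'k::idom mpoly \<Rightarrow> 'k mpoly"
    and W :: "(nat \<Rightarrow>\<^sub>0 nat) \<Rightarrow> 'g::linordered_ab_group_add"
  assumes F: "algebra_automorphism m F" and j: "j \<in> {1..m}" "f = F (Var j)"
    and I: "I \<subseteq> {1..m}" "f \<in> polys_in I" "i \<in> I"
    and W_add: "\<And>a b. W (a + b) = W a + W b"
    and top: "a0 \<in> Poly_Mapping.keys f" "\<And>a. a \<in> Poly_Mapping.keys f \<Longrightarrow> W a \<le> W a0"
    and full: "\<And>a i. a \<in> Poly_Mapping.keys f \<Longrightarrow> W a = W a0 \<Longrightarrow> i \<in> I \<Longrightarrow> Poly_Mapping.lookup a i \<noteq> 0"
  shows "W (Poly_Mapping.single i 1) = W a0"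
proof -
  let ?P = "polys_in {1..m} :: 'k mpoly set"
  have bij: "bij_betw F ?P ?P"
    using F by (simp add: algebra_automorphism_def polys_eq_polys_in)
  have F_subst: "F p = subst (\<lambda>l. F (Var l)) p" if "p \<in> ?P" for p
    using automorphism_eq_subst[OF F] that by (simp add: polys_eq_polys_in)
  have F_Var: "F (Var l) \<in> ?P" if "l \<in> {1..m}" for l
    using bij_betwE[OF bij] that by simp
  have "\<forall>l\<in>{1..m}. \<exists>p. p \<in> ?P \<and> F p = Var l"
  proof
    fix l assume "l \<in> {1..m}"
    then have "Var l \<in> F ` ?P" using bij by (simp add: bij_betw_def)
    then show "\<exists>p. p \<in> ?P \<and> F p = Var l" by auto
  qed
  then obtain g where g: "\<And>l. l \<in> {1..m} \<Longrightarrow> g l \<in> ?P" "\<And>l. l \<in> {1..m} \<Longrightarrow> F (g l) = Var l"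
    by metis
  have "f \<in> ?P" using polys_in_mono[OF I(1) I(2)] .
  have "F (subst g f) = subst (\<lambda>l. subst (\<lambda>l. F (Var l)) (g l)) f"
    using polys_in_subst[OF \<open>f \<in> ?P\<close>, of g] g(1) by (subst F_subst) (auto simp: subst_subst)
  also have "\<dots> = subst Var f"
    using \<open>f \<in> ?P\<close> g F_subst by (intro subst_cong) auto
  finally have "F (subst g f) = F (Var j)" by (simp add: j)
  then have g_f: "subst g f = Var j"
    using inj_onD[OF bij_betw_imp_inj_on[OF bij], of "subst g f" "Var j"] j(1)
      polys_in_subst[OF \<open>f \<in> ?P\<close>, of g] g(1) by simp
  define \<sigma> where "\<sigma> l = (if l = j then F (Var l) else F (Var l) * (1 + Var 0))" for l
  define s where "s l = subst \<sigma> (g l)" for l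
  have s_f: "subst s f = f"
    using g_f by (simp add: s_def[abs_def] subst_subst[symmetric] \<sigma>_def j)
  have set_\<sigma>: "subst (Var(0 := c)) (\<sigma> l) = (if l = j then F (Var l) else F (Var l) * (1 + c))"
    if "l \<in> {1..m}" for l c
  proof -
    have "subst (Var(0 := c)) (F (Var l)) = subst Var (F (Var l))"
      by (rule subst_cong[OF F_Var[OF that]]) auto
    then show ?thesis by (cases "l = j") (simp_all add: \<sigma>_def subst_mult subst_add)
  qed
  have zero_s: "set_to_zero 0 (s l) = Var l" if "l \<in> {1..m}" for l
  proof -
    have "set_to_zero 0 (s l) = subst (\<lambda>l. subst (Var(0 := 0)) (\<sigma> l)) (g l)"
      by (simp add: set_to_zero_def s_def subst_subst)
    also have "\<dots> = subst (\<lambda>l. F (Var l)) (g l)"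
      using set_\<sigma>[of _ 0] by (intro subst_cong[OF g(1)[OF that]]) auto
    finally show ?thesis using g[OF that] F_subst by simp
  qed
  have i: "i \<in> {1..m}" using I by blast
  (* A monomial of s i divisible by Var 0 would force some leading monomial of f to omit a
     variable in I, contrary to the assumption full. *)
  have unmoved: "Poly_Mapping.lookup (s i) b = 0" if "Poly_Mapping.lookup b 0 \<noteq> 0" for b
  proof (rule ccontr)
    assume "Poly_Mapping.lookup (s i) b \<noteq> 0"
    then have "b \<in> Poly_Mapping.keys (s i)" by (simp add: in_keys_iff)
    with that have "\<exists>a\<in>Poly_Mapping.keys f. W a = W a0 \<and> (\<exists>i\<in>I. Poly_Mapping.lookup a i = 0)"
      using I(1) zero_s finite_subset[OF I(1)] W_add
      by (intro subst_fixing_fixes_leading_factors[where s = s and W = W and z = 0 and f = f and I = I, OF _ _ _ I(2) s_f _ I(3) _ _ top]) auto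
    then show False using full by blast
  qed
  have "s i = set_to_zero 0 (s i)"
    using unmoved by (intro poly_mapping_eqI) (simp add: lookup_set_to_zero unmoved)
  then have s_i: "s i = Var i" using zero_s[OF i] by simp
  have "Var i = subst (Var(0 := - 1)) (s i)"
    using i by (simp add: s_i)
  also have "\<dots> = subst (\<lambda>l. subst (Var(0 := - 1)) (\<sigma> l)) (g i)"
    by (simp add: s_def subst_subst)
  also have "\<dots> = subst (\<lambda>l. if l = j then f else 0) (g i)"
    using set_\<sigma>[of _ "- 1"] j by (intro subst_cong[OF g(1)[OF i]]) auto
  finally have "Var i = subst (\<lambda>l. if l = j then f else 0) (g i)" .
  moreover have "\<exists>c r. subst (\<lambda>l. if l = j then f else 0) (g i) = Const c + f * r"
    by (rule subst_multiples) simp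
  ultimately obtain c r where "Var i = Const c + f * r" by metis
  then have fr: "f * r = Var i - Const c" by simp
  interpret weighted_order W 0
    by unfold_locales (rule W_add)
  have "Poly_Mapping.lookup (f * r) (Poly_Mapping.single i 1) = 1"
    unfolding fr by (simp add: Var_def Const_def lookup_minus lookup_single)
  then have "f * r \<noteq> 0" by auto
  then obtain a b where lead: "leading f a" "leading r b"
    using ex_leading[of f] ex_leading[of r] by auto
  have W_a: "W a = W a0"
    using top(2)[OF leading_in_keys[OF lead(1)]] leading_weight[OF lead(1) top(1)] by simp
  have a_i: "Poly_Mapping.lookup a i \<noteq> 0"
    using full[OF leading_in_keys[OF lead(1)] W_a I(3)] .
  have "a + b \<in> Poly_Mapping.keys (f * r)"
    using leading_in_keys[OF leading_mult[OF lead]] .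
  (* f * r is x_i minus a constant, and its leading monomial is a multiple of that of f. *)
  then have "a + b \<in> {0, Poly_Mapping.single i 1}"
    unfolding fr by (auto simp: in_keys_iff lookup_minus Var_def Const_def lookup_single when_def split: if_splits)
  moreover have "a + b \<noteq> 0"
  proof
    assume "a + b = 0"
    then have "Poly_Mapping.lookup (a + b) i = 0" by simp
    with a_i show False by (simp add: lookup_add)
  qed
  ultimately have ab: "a + b = Poly_Mapping.single i 1" by simp
  have "a = Poly_Mapping.single i 1"
  proof (rule poly_mapping_eqI)
    fix l
    have "Poly_Mapping.lookup a l + Poly_Mapping.lookup b l = (if l = i then 1 else 0)"
      unfolding lookup_add[symmetric] ab by (auto simp: lookup_single when_def)
    then show "Poly_Mapping.lookup a l = Poly_Mapping.lookup (Poly_Mapping.single i 1) l"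
      using a_i by (cases "l = i") (auto simp: lookup_single)
  qed
  then show ?thesis using W_a by simp
qed

lemma algebra_automorphism_nonconstant:
  assumes "algebra_automorphism m F" "j \<in> {1..m}"
  shows "F (Var j) \<noteq> Const (c :: 'k::idom)"
proof
  assume "F (Var j) = Const c"
  then have "F (Var j) = F (Const c)" using assms(1) by (simp add: algebra_automorphism_def)
  then have "Var j = Const c"
    using assms unfolding algebra_automorphism_def polys_eq_polys_in
    by (metis bij_betw_imp_inj_on inj_onD polys_in_Const polys_in_Var)
  then have "Poly_Mapping.lookup (Var j) (Poly_Mapping.single j 1) = Poly_Mapping.lookup (Const c) (Poly_Mapping.single j 1)"
    by simp
  then show False by (simp add: Var_def Const_def lookup_single)
qed

lemma elementary_coordinate:
  fixes q :: "'k::idom mpoly"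
  assumes "i \<in> {1..n}" "q \<in> polys_in ({1..n} - {i})"
  shows "coordinate n (Var i + q)"
proof -
  let ?E = "\<lambda>q. subst (Var(i := Var i + q))"
  have q: "q \<in> polys n" using assms(2) by (auto simp: polys_eq_polys_in intro: polys_in_mono[rotated])
  have inv: "?E r (?E (- r) p) = p" if "r \<in> polys_in ({1..n} - {i})" for r p :: "'k mpoly"
  proof -
    have "?E r (- r) = subst Var (- r)"
      by (rule subst_cong[OF polys_in_uminus[OF that]]) auto
    then have "?E r ((Var(i := Var i + - r)) l) = Var l" for l
      by (cases "l = i") (simp_all add: subst_diff subst_uminus)
    then show ?thesis by (simp add: subst_subst del: fun_upd_apply)
  qed
  have closed: "?E r p \<in> polys n" if "p \<in> polys n" "r \<in> polys n" for r p
    using that assms(1) unfolding polys_eq_polys_in by (auto intro!: polys_in_subst polys_in_add)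
  have "bij_betw (?E q) (polys n) (polys n)"
  proof (rule bij_betw_byWitness[of _ "?E (- q)"])
    show "\<forall>p\<in>polys n. ?E (- q) (?E q p) = p"
      using inv[OF polys_in_uminus[OF assms(2)]] by simp
    show "\<forall>p\<in>polys n. ?E q (?E (- q) p) = p"
      using inv[OF assms(2)] by simp
    show "?E q ` polys n \<subseteq> polys n"
      using closed[OF _ q] by blast
    show "?E (- q) ` polys n \<subseteq> polys n"
      using closed[of _ "- q"] q polys_in_uminus[of q] unfolding polys_eq_polys_in by blast
  qed
  then have "algebra_automorphism n (?E q)"
    by (simp add: algebra_automorphism_def subst_add subst_mult)
  moreover have "Var i + q = ?E q (Var i)" by simp
  ultimately show ?thesis unfolding coordinate_def using assms(1) by blast
qed

theorem theorem1p4: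
  fixes n :: nat
    and w :: "nat \<Rightarrow> 'g::linordered_ab_group_add"
  assumes "n \<ge> 1"
    and "\<And>i. i \<in> {1..n} \<Longrightarrow> w i \<ge> 0"
  shows "C_over n w TYPE('k::idom) = C_set n w \<union> w ` {1..n}"
proof -
  define W where "W a = (\<Sum>i = 1..n. Poly_Mapping.lookup a i \<cdot> w i)" for a :: "nat \<Rightarrow>\<^sub>0 nat"
  have W_add: "W (a + b) = W a + W b" for a b
    by (simp add: W_def lookup_add nat_times_add_left sum.distrib)
  have W_single: "W (Poly_Mapping.single i 1) = w i" if "i \<in> {1..n}" for i
  proof -
    have "W (Poly_Mapping.single i 1) = (\<Sum>l = 1..n. if l = i then w i else 0)"
      unfolding W_def by (intro sum.cong) (auto simp: lookup_single)
    then show ?thesis using that by simp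
  qed
  have wdeg_W: "wdeg n w f = Max (W ` Poly_Mapping.keys f)" for f :: "'k mpoly"
    by (simp add: wdeg_def W_def[abs_def])
  show ?thesis
  proof (intro set_eqI iffI)
    fix d assume "d \<in> C_over n w TYPE('k)"
    then obtain f :: "'k mpoly" and m F j where f: "d = wdeg n w f" "f \<in> polys n"
      and "n \<le> m" and F: "algebra_automorphism m F" and j: "j \<in> {1..m}" "f = F (Var j)"
      by (auto simp: C_over_def stable_coordinate_def coordinate_def)
    have "\<not> Poly_Mapping.keys f \<subseteq> {0}"
    proof
      assume "Poly_Mapping.keys f \<subseteq> {0}"
      then have "f = Const (Poly_Mapping.lookup f 0)"
        by (intro poly_mapping_eqI) (auto simp: Const_def lookup_single when_def in_keys_iff)
      then show False using algebra_automorphism_nonconstant[OF F j(1)] j(2) by metis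
    qed
    then obtain b where b: "b \<in> Poly_Mapping.keys f" "b \<noteq> 0" by auto
    have d_Max: "d = Max (W ` Poly_Mapping.keys f)" using f(1) wdeg_W by simp
    have W_le: "W a \<le> d" if "a \<in> Poly_Mapping.keys f" for a
      unfolding d_Max using that by (intro Max_ge) auto
    have "d \<in> W ` Poly_Mapping.keys f"
      unfolding d_Max using b(1) by (intro Max_in) auto
    then obtain a0 where a0: "a0 \<in> Poly_Mapping.keys f" "W a0 = d" by auto
    (* Heavier variables cannot occur in f, because all weights are nonnegative. *)
    define I where "I = {i \<in> {1..n}. w i \<le> d}"
    have keys_I: "Poly_Mapping.keys a \<subseteq> I" if "a \<in> Poly_Mapping.keys f" for a
    proof
      fix l assume l: "l \<in> Poly_Mapping.keys a"
      then have ln: "l \<in> {1..n}" using f(2) that unfolding polys_def by blast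
      have "w l \<le> Poly_Mapping.lookup a l \<cdot> w l"
        using l assms(2)[OF ln] by (intro nat_times_ge) (auto simp: in_keys_iff)
      also have "\<dots> \<le> W a"
        unfolding W_def using ln assms(2)
        by (subst sum.remove[of _ l]) (auto intro!: sum_nonneg nat_times_nonneg)
      also have "\<dots> \<le> d" by (rule W_le[OF that])
      finally show "l \<in> I" using ln by (simp add: I_def)
    qed
    have "Poly_Mapping.keys b \<noteq> {}" using b(2) by simp
    then obtain i where i: "i \<in> I" using keys_I[OF b(1)] by blast
    show "d \<in> C_set n w \<union> w ` {1..n}"
    proof (cases "\<exists>a\<in>Poly_Mapping.keys f. W a = d \<and> (\<exists>i\<in>I. Poly_Mapping.lookup a i = 0)")
      case True
      then obtain a i where a: "W a = d" "i \<in> I" "Poly_Mapping.lookup a i = 0" by blast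
      have "d = (\<Sum>l \<in> {1..n} - {i}. Poly_Mapping.lookup a l \<cdot> w l)"
        using a unfolding W_def I_def by (subst (asm) sum.remove[of _ i]) auto
      then show ?thesis using a(2) by (auto simp: C_set_def I_def)
    next
      case False
      have "W (Poly_Mapping.single i 1) = W a0"
      proof (rule coordinate_leading_monomials[OF F j _ _ i W_add a0(1)])
        show "I \<subseteq> {1..m}" using \<open>n \<le> m\<close> by (auto simp: I_def)
        show "f \<in> polys_in I" using keys_I by (auto simp: polys_in_def)
      qed (use False W_le a0(2) in auto)
      then have "d = w i" using W_single[of i] i a0(2) by (simp add: I_def)
      then show ?thesis using i by (auto simp: I_def)
    qed
  next
    fix d assume "d \<in> C_set n w \<union> w ` {1..n}"
    then show "d \<in> C_over n w TYPE('k)"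
    proof
      assume "d \<in> w ` {1..n}"
      then obtain i where i: "i \<in> {1..n}" "d = w i" by blast
      have "coordinate n (Var i :: 'k mpoly)"
        using elementary_coordinate[OF i(1), of 0] by (simp add: polys_in_def)
      then have "stable_coordinate n (Var i :: 'k mpoly)"
        using i(1) by (auto simp: stable_coordinate_def polys_eq_polys_in)
      moreover have "wdeg n w (Var i :: 'k mpoly) = d"
        using W_single[OF i(1)] i(2) by (simp add: wdeg_W Var_def)
      ultimately show ?thesis unfolding C_over_def by blast
    next
      assume "d \<in> C_set n w"
      then obtain i c where i: "i \<in> {1..n}" "d \<ge> w i" and d: "d = (\<Sum>l \<in> {1..n} - {i}. c l \<cdot> w l)"
        by (auto simp: C_set_def)
      define a where "a = (\<Sum>l \<in> {1..n} - {i}. Poly_Mapping.single l (c l))"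
      define q :: "'k mpoly" where "q = Poly_Mapping.single a 1"
      have lookup_a: "Poly_Mapping.lookup a l = (if l \<in> {1..n} - {i} then c l else 0)" for l
        unfolding a_def lookup_sum lookup_single when_def by simp
      have "W a = (\<Sum>l \<in> {1..n} - {i}. c l \<cdot> w l)"
        unfolding W_def using i(1) by (subst sum.remove[of _ i]) (auto simp: lookup_a intro!: sum.cong)
      then have W_a: "W a = d" using d by simp
      have q: "q \<in> polys_in ({1..n} - {i})"
        by (auto simp: q_def polys_in_def in_keys_iff lookup_a split: if_splits)
      have "Var i + q \<in> polys n"
        using q i(1) polys_in_mono[OF _ q, of "{1..n}"] by (auto simp: polys_eq_polys_in intro!: polys_in_add)
      then have "stable_coordinate n (Var i + q)"
        using elementary_coordinate[OF i(1) q] by (auto simp: stable_coordinate_def)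
      moreover have "Poly_Mapping.keys (Var i + q) = {Poly_Mapping.single i 1, a}"
      proof -
        have "Poly_Mapping.lookup a i \<noteq> Poly_Mapping.lookup (Poly_Mapping.single i 1) i"
          by (simp add: lookup_a)
        then have "a \<noteq> Poly_Mapping.single i 1" by auto
        then show ?thesis
          by (auto simp: Var_def q_def in_keys_iff lookup_add lookup_single when_def split: if_splits)
      qed
      then have "wdeg n w (Var i + q) = d"
        using i(2) W_single[OF i(1)] W_a by (simp add: wdeg_W max_def)
      ultimately show ?thesis unfolding C_over_def by blast
    qed
  qed
qed

end
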